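(* Let $k>0$ be a real number and let $l\in\{0,1,2,3\}$. For $(\mathbf{x},t)\in\mathbb{R}^3\times\mathbb{R}^+$ let $$E(\mathbf{x},t;k)=\sqrt{k}\,\frac{H(t)\exp\left(-\frac{k|\mathbf{x}|^2}{4t}\right)}{(2\sqrt{\pi t})^3}\left(\frac{k}{2t}\sum_{j=1}^3 e_jx_j+\mathfrak{f}\left(\frac{3}{2t}+\frac{k|\mathbf{x}|^2}{4t^2}\right)+k^2\mathfrak{f}^{\dagger}\right).$$ Then the series $$\mathcal{E}(\mathbf{x},t;k)=\sum_{\omega\in\mathbb{Z}^l\oplus\mathbb{Z}^{3-l}}(-1)^{m_1+\cdots+m_l}\,E(\mathbf{x}+\omega,t;k)$$ converges uniformly on every compact subset of $\mathbb{R}^3\times\mathbb{R}^+$.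
   Context: Here $\mathbb{R}^+=(0,\infty)$, $|\mathbf{x}|$ is the Euclidean norm of $\mathbf{x}=x_1e_1+x_2e_2+x_3e_3\in\mathbb{R}^3$, where $e_1,e_2,e_3$ is the standard basis of $\mathbb{R}^3$, and $H$ is the Heaviside function (so $H(t)=1$ for $t>0$). The symbols $\mathfrak{f},\mathfrak{f}^{\dagger}$ are two additional basis elements (a Witt basis) adjoined to $e_1,e_2,e_3$. For this statement only the linear structure matters: $E(\cdot,\cdot;k)$ takes values in the 5-dimensional real vector space with basis $e_1,e_2,e_3,\mathfrak{f},\mathfrak{f}^{\dagger}$, equipped with any norm (all are equivalent), and convergence is understood in that space (equivalently, coordinatewise). The lattice is split as $\mathbb{Z}^l=\mathbb{Z}e_1+\cdots+\mathbb{Z}e_l$ and $\mathbb{Z}^{3-l}=\mathbb{Z}e_{l+1}+\cdots+\mathbb{Z}e_3$, so that $\mathbb{Z}^l\oplus\mathbb{Z}^{3-l}=\mathbb{Z}e_1+\mathbb{Z}e_2+\mathbb{Z}e_3$. Every $\omega$ in it is written uniquely as $\omega=\underline{m}+\underline{n}$ with $\underline{m}=m_1e_1+\cdots+m_le_l\in\mathbb{Z}^l$ and $\underline{n}\in\mathbb{Z}^{3-l}$; the integers $m_1,\dots,m_l$ in the sign $(-1)^{m_1+\cdots+m_l}$ are these coordinates of $\omega$. For $l=0$ one has $\mathbb{Z}^0=\{0\}$ and the sign is always $+1$; for $l=3$, likewise $\mathbb{Z}^{3-l}=\{0\}$. Uniform convergence of the lattice series on a compact set $K$ means that the finite partial sums,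 indexed by the finite subsets of the lattice directed by inclusion, converge uniformly on $K$. *)

theory Defs
  imports "HOL-Analysis.Analysis"
begin

text \<open>
  The real vector space with basis \<open>e\<^sub>1, e\<^sub>2, e\<^sub>3, \<ff>, \<ff>\<^sup>\<dagger>\<close>: the first component
  carries the coordinates with respect to \<open>e\<^sub>1, e\<^sub>2, e\<^sub>3\<close>, the other two those with respect to
  \<open>\<ff>\<close> and \<open>\<ff>\<^sup>\<dagger>\<close>.  Only the linear structure is used, so the Clifford product is not modelled;
  the norm is the Euclidean one of the product type.
\<close>

type_synonym witt_space = "(real ^ 3) \<times> real \<times> real"

definition e_basis :: "3 \<Rightarrow> witt_space" where
  "e_basis j = (axis j 1, 0, 0)"

definition witt_f :: witt_space where
  "witt_f = (0, 1, 0)"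

definition witt_f_dagger :: witt_space where
  "witt_f_dagger = (0, 0, 1)"

text \<open>The value at \<open>0\<close> is immaterial, as the kernel below is only considered for \<open>t > 0\<close>.\<close>

definition heaviside :: "real \<Rightarrow> real" where
  "heaviside t = (if t > 0 then 1 else 0)"

definition fund_sol :: "real \<Rightarrow> real ^ 3 \<Rightarrow> real \<Rightarrow> witt_space" where
  "fund_sol k x t =
     (sqrt k * (heaviside t * exp (- (k * (norm x)\<^sup>2 / (4 * t))) / (2 * sqrt (pi * t)) ^ 3)) *\<^sub>R
       ((k / (2 * t)) *\<^sub>R (\<Sum>j\<in>UNIV. (x $ j) *\<^sub>R e_basis j)
        + (3 / (2 * t) + k * (norm x)\<^sup>2 / (4 * t\<^sup>2)) *\<^sub>R witt_f
        + k\<^sup>2 *\<^sub>R witt_f_dagger)"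

text \<open>
  The standard basis vectors are indexed by natural numbers \<open>1, 2, 3\<close> through \<open>of_nat\<close> into the
  index type \<open>3\<close>, where \<open>3 = 0\<close>; this map is a bijection on \<open>{1..3}\<close>.
\<close>

definition int_span :: "nat set \<Rightarrow> (real ^ 3) set" where
  "int_span J = {(\<Sum>j\<in>J. of_int (m j) *\<^sub>R axis (of_nat j) 1) | m :: nat \<Rightarrow> int. True}"

definition split_lattice :: "nat \<Rightarrow> (real ^ 3) set" where
  "split_lattice l = {m + n | m n. m \<in> int_span {1..l} \<and> n \<in> int_span {l + 1..3}}"

text \<open>
  On lattice points the coordinates are integers, so the floor merely turns the real
  coordinate \<open>m\<^sub>j\<close> into a value of type \<^typ>\<open>int\<close>.
\<close>

definition lattice_sign :: "nat \<Rightarrow> real ^ 3 \<Rightarrow> real" where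
  "lattice_sign l \<omega> = (-1) powi (\<Sum>j=1..l. \<lfloor>\<omega> $ of_nat j\<rfloor>)"

definition lattice_term :: "nat \<Rightarrow> real \<Rightarrow> real ^ 3 \<Rightarrow> real ^ 3 \<Rightarrow> real \<Rightarrow> witt_space" where
  "lattice_term l k \<omega> x t = lattice_sign l \<omega> *\<^sub>R fund_sol k (x + \<omega>) t"

definition lattice_series :: "nat \<Rightarrow> real \<Rightarrow> real ^ 3 \<Rightarrow> real \<Rightarrow> witt_space" where
  "lattice_series l k x t = (\<Sum>\<^sub>\<infinity>\<omega>\<in>split_lattice l. lattice_term l k \<omega> x t)"

end

theory Submission
  imports Defs
begin

text \<open>
  On a compact set \<open>K\<close> one has \<open>|x| \<le> R\<close> and \<open>0 < a \<le> t \<le> b\<close>.  The exponential in the kernel absorbs the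
  polynomial factor, and \<open>|x + \<omega>|\<^sup>2 \<ge> |\<omega>|\<^sup>2 / 2 - R\<^sup>2\<close> removes the dependence on \<open>x\<close>, so that every term
  is bounded on \<open>K\<close> by a constant times the Gaussian \<open>exp (- c |\<omega>|\<^sup>2)\<close> with \<open>c = k / (16 b)\<close>.  The Gaussian
  is a product over the coordinates, hence summable over the integer points, and the Weierstrass
  M-test applies.
\<close>

text \<open>Since n \<le> n^2 for natural n, the half with n \<ge> 0 is dominated by a geometric
  series of ratio \<open>exp (- c)\<close> < 1; evenness of the Gaussian gives the other
  half.\<close>

lemma summable_on_int_gaussian:
  fixes c :: real
  assumes "c > 0"
  shows "(\<lambda>n::int. exp (- c * (of_int n)\<^sup>2)) summable_on UNIV"
proof -
  let ?f = "\<lambda>n::int. exp (- c * (real_of_int n)\<^sup>2)"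
  have le: "exp (- c * (real n)\<^sup>2) \<le> exp (- c) ^ n" for n :: nat
  proof -
    have "real n \<le> (real n)\<^sup>2"
      by (simp add: power2_eq_square flip: of_nat_mult)
    then have "- c * (real n)\<^sup>2 \<le> real n * (- c)"
      using assms by simp
    then show ?thesis
      by (metis exp_le_cancel_iff exp_of_nat_mult)
  qed
  have "summable (\<lambda>n::nat. exp (- c) ^ n)"
    using assms by (simp add: summable_geometric)
  then have "summable (\<lambda>n::nat. exp (- c * (real n)\<^sup>2))"
    by (rule summable_comparison_test') (use le in simp)
  then have nat: "(\<lambda>n::nat. exp (- c * (real n)\<^sup>2)) summable_on UNIV"
    by (subst summable_on_UNIV_nonneg_real_iff) auto
  have "?f summable_on range int"
    using nat by (subst summable_on_reindex) (auto simp: o_def)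
  moreover have "?f summable_on range (\<lambda>n. - int n)"
    using nat by (subst summable_on_reindex) (auto simp: o_def inj_on_def)
  ultimately have "?f summable_on (range int \<union> range (\<lambda>n. - int n))"
    by (rule summable_on_union)
  moreover have "UNIV \<subseteq> range int \<union> range (\<lambda>n. - int n)"
  proof
    show "n \<in> range int \<union> range (\<lambda>n. - int n)" for n
      by (cases n rule: int_cases2) auto
  qed
  ultimately show ?thesis by (rule summable_on_subset)
qed

text \<open>The squared norm is a sum over coordinates, so the Gaussian is a product of
  one-dimensional ones, and a finite product of absolutely summable families is absolutely summable
  over the product index set.\<close>

lemma summable_on_integer_points_gaussian:
  fixes c :: real
  assumes "c > 0"
  shows "(\<lambda>\<omega>::real ^ 'n. exp (- c * (norm \<omega>)\<^sup>2)) summable_on {\<omega>. \<forall>j. \<omega> $ j \<in> \<int>}"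
proof -
  let ?v = "\<lambda>m::'n \<Rightarrow> int. \<chi> j. real_of_int (m j)"
  \<comment> \<open>The coordinate functions are viewed as the full product
    \<open>PiE UNIV (\<lambda>_. UNIV)\<close>, so that the product rule applies.\<close>
  have "Infinite_Set_Sum.abs_summable_on
          (\<lambda>m::'n \<Rightarrow> int. \<Prod>j\<in>UNIV. exp (- c * (real_of_int (m j))\<^sup>2)) (PiE UNIV (\<lambda>_. UNIV))"
    by (rule abs_summable_on_prod_PiE)
       (use summable_on_int_gaussian[OF assms] in \<open>auto simp flip: abs_summable_equivalent\<close>)
  then have "(\<lambda>m::'n \<Rightarrow> int. \<Prod>j\<in>UNIV. exp (- c * (real_of_int (m j))\<^sup>2)) summable_on UNIV"
    by (simp flip: abs_summable_equivalent add: abs_prod)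
  moreover have "(\<Prod>j\<in>UNIV. exp (- c * (real_of_int (m j))\<^sup>2)) = exp (- c * (norm (?v m))\<^sup>2)" for m
    by (simp add: norm_vec_def L2_set_def sum_nonneg sum_distrib_left flip: exp_sum)
  ultimately have "(\<lambda>m. exp (- c * (norm (?v m))\<^sup>2)) summable_on UNIV"
    by simp
  moreover have "inj ?v"
    by (auto simp: inj_on_def vec_eq_iff)
  ultimately have "(\<lambda>\<omega>::real ^ 'n. exp (- c * (norm \<omega>)\<^sup>2)) summable_on range ?v"
    by (subst summable_on_reindex) (auto simp: o_def)
  moreover have "{\<omega>::real ^ 'n. \<forall>j. \<omega> $ j \<in> \<int>} = range ?v"
  proof (intro equalityI subsetI)
    fix \<omega> :: "real ^ 'n" assume "\<omega> \<in> {\<omega>. \<forall>j. \<omega> $ j \<in> \<int>}"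
    then have "\<omega> = ?v (\<lambda>j. \<lfloor>\<omega> $ j\<rfloor>)"
      by (simp add: vec_eq_iff)
    then show "\<omega> \<in> range ?v"
      by (rule image_eqI[where f = ?v and x = "\<lambda>j. \<lfloor>\<omega> $ j\<rfloor>"]) simp
  qed auto
  ultimately show ?thesis by simp
qed

lemma int_span_coordinate_Ints: "\<omega> \<in> int_span J \<Longrightarrow> \<omega> $ j \<in> \<int>"
  unfolding int_span_def by (auto simp: axis_def intro!: Ints_sum Ints_mult)

text \<open>Places the lattice inside the integer points, so that it inherits summability of the
  Gaussian as a subset.\<close>

lemma split_lattice_coordinate_Ints: "\<omega> \<in> split_lattice l \<Longrightarrow> \<omega> $ j \<in> \<int>"
  unfolding split_lattice_def by (auto intro!: Ints_add dest: int_span_coordinate_Ints)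

lemma abs_lattice_sign: "\<bar>lattice_sign l \<omega>\<bar> = 1"
  by (simp add: lattice_sign_def power_int_abs)

text \<open>The difference of the two sides is half of |2x + y|^2.\<close>

lemma norm_sq_add_ge:
  fixes x y :: "'a::real_inner"
  shows "(norm (x + y))\<^sup>2 \<ge> (norm y)\<^sup>2 / 2 - (norm x)\<^sup>2"
proof -
  have "0 \<le> (norm (2 *\<^sub>R x + y))\<^sup>2" by simp
  then show ?thesis
    by (simp add: power2_norm_eq_inner inner_add_left inner_add_right inner_commute)
qed

text \<open>Triangle inequality over the three components: \<open>witt_f\<close> and
  \<open>witt_f_dagger\<close> are unit vectors, and the sum over the \<open>e_basis j\<close> is y
  itself, embedded isometrically.\<close>

lemma norm_fund_sol_le:
  assumes "k > 0" "t > 0"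
  shows "norm (fund_sol k y t) \<le>
    sqrt k * exp (- (k * (norm y)\<^sup>2 / (4 * t))) / (2 * sqrt (pi * t)) ^ 3 *
    (k / (2 * t) * norm y + (3 / (2 * t) + k * (norm y)\<^sup>2 / (4 * t\<^sup>2)) + k\<^sup>2)"
proof -
  have sum: "(\<Sum>j\<in>UNIV. (y $ j) *\<^sub>R e_basis j) = (y, 0, 0)"
    using basis_expansion[of y]
    by (simp add: e_basis_def prod_eq_iff fst_sum snd_sum scalar_mult_eq_scaleR)
  have coords: "norm (c *\<^sub>R (y, 0::real, 0::real) + d *\<^sub>R witt_f + e *\<^sub>R witt_f_dagger)
      \<le> c * norm y + d + e" if "c \<ge> 0" "d \<ge> 0" "e \<ge> 0" for c d e :: real
  proof -
    have "norm (y, 0::real, 0::real) = norm y" "norm witt_f = 1" "norm witt_f_dagger = 1"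
      by (simp_all add: norm_Pair witt_f_def witt_f_dagger_def)
    then have "norm (c *\<^sub>R (y, 0::real, 0::real)) = c * norm y" "norm (d *\<^sub>R witt_f) = d"
      "norm (e *\<^sub>R witt_f_dagger) = e"
      using that by (simp_all only: norm_scaleR abs_of_nonneg mult_1_right)
    then show ?thesis
      using norm_triangle_ineq[of "c *\<^sub>R (y, 0::real, 0::real) + d *\<^sub>R witt_f" "e *\<^sub>R witt_f_dagger"]
        norm_triangle_ineq[of "c *\<^sub>R (y, 0::real, 0::real)" "d *\<^sub>R witt_f"] by linarith
  qed
  have "0 \<le> sqrt k * (heaviside t * exp (- (k * (norm y)\<^sup>2 / (4 * t))) / (2 * sqrt (pi * t)) ^ 3)"
    using assms by (simp add: heaviside_def)
  then have "norm (fund_sol k y t) \<le>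
      sqrt k * (heaviside t * exp (- (k * (norm y)\<^sup>2 / (4 * t))) / (2 * sqrt (pi * t)) ^ 3) *
      (k / (2 * t) * norm y + (3 / (2 * t) + k * (norm y)\<^sup>2 / (4 * t\<^sup>2)) + k\<^sup>2)"
    unfolding fund_sol_def norm_scaleR sum using assms
    by (simp only: abs_of_nonneg) (intro mult_left_mono coords; simp)
  then show ?thesis
    using assms by (simp add: heaviside_def)
qed

text \<open>For t \<le> b the kernel decays at rate at least k / (4b). Half of this rate pays for
  the polynomial factor; the other half, k / (8b), remains.\<close>

lemma fund_sol_gaussian_bound:
  fixes k a b :: real
  assumes "k > 0" "a > 0" "b > 0"
  obtains C where "C \<ge> 0"
    and "\<And>y t. a \<le> t \<Longrightarrow> t \<le> b \<Longrightarrow> norm (fund_sol k y t) \<le> C * exp (- (k / (8 * b)) * (norm y)\<^sup>2)"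
proof
  define c where "c = k / (8 * b)"
  \<comment> \<open>A and B bound the coefficients of the polynomial factor by their values at t =
    a. The term k / (2a) occurs in both because |y| is replaced by 1 + |y|^2. P is the prefactor at
    t = a, where it is largest.\<close>
  define A where "A = k / (2 * a) + 3 / (2 * a) + k\<^sup>2"
  define B where "B = k / (2 * a) + k / (4 * a\<^sup>2)"
  define P where "P = sqrt k / (2 * sqrt (pi * a)) ^ 3"
  have pos: "c > 0" "A \<ge> 0" "B \<ge> 0" "P \<ge> 0"
    using assms by (auto simp: c_def A_def B_def P_def)
  show "P * (A + B / c) \<ge> 0"
    using pos by simp
  fix y :: "real ^ 3" and t :: real
  assume t: "a \<le> t" "t \<le> b"
  then have "t > 0" using assms by simp
  define s where "s = norm y"
  have "s \<ge> 0" by (simp add: s_def)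
  have "s \<le> 1 + s\<^sup>2"
    by (smt (verit) self_le_power pos2 power2_eq_square zero_le_square)
  have poly: "k / (2 * t) * s + (3 / (2 * t) + k * s\<^sup>2 / (4 * t\<^sup>2)) + k\<^sup>2 \<le> A + B * s\<^sup>2"
  proof -
    have "k / (2 * t) * s \<le> k / (2 * a) * (1 + s\<^sup>2)"
      using assms t \<open>s \<le> 1 + s\<^sup>2\<close> \<open>s \<ge> 0\<close> by (intro mult_mono divide_left_mono) auto
    moreover have "3 / (2 * t) \<le> 3 / (2 * a)"
      using assms t by (intro divide_left_mono) auto
    moreover have "k * s\<^sup>2 / (4 * t\<^sup>2) \<le> k * s\<^sup>2 / (4 * a\<^sup>2)"
      using assms t by (intro divide_left_mono mult_left_mono power_mono) auto
    ultimately show ?thesis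
      by (simp add: A_def B_def distrib_left distrib_right add_divide_distrib)
  qed
  \<comment> \<open>Uses 1 \<le> exp u and u \<le> exp u for u = c s^2.\<close>
  have absorb: "A + B * s\<^sup>2 \<le> (A + B / c) * exp (c * s\<^sup>2)"
  proof -
    have "A \<le> A * exp (c * s\<^sup>2)"
      using pos mult_left_mono[of 1 "exp (c * s\<^sup>2)" A] by simp
    moreover have "B * s\<^sup>2 = B / c * (c * s\<^sup>2)"
      using pos by simp
    moreover have "B / c * (c * s\<^sup>2) \<le> B / c * exp (c * s\<^sup>2)"
      using pos exp_ge_add_one_self[of "c * s\<^sup>2"] by (intro mult_left_mono) (linarith, simp)
    ultimately show ?thesis by (simp add: algebra_simps)
  qed
  \<comment> \<open>Here 2c = k / (4b) is the smallest decay rate, attained at t = b.\<close>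
  have expo: "exp (- (k * s\<^sup>2 / (4 * t))) \<le> exp (- 2 * c * s\<^sup>2)"
  proof -
    have "k * s\<^sup>2 / (4 * b) \<le> k * s\<^sup>2 / (4 * t)"
      using assms t \<open>t > 0\<close> by (intro divide_left_mono mult_left_mono) auto
    then show ?thesis by (simp add: c_def)
  qed
  have pre: "sqrt k * exp (- (k * s\<^sup>2 / (4 * t))) / (2 * sqrt (pi * t)) ^ 3 \<le> P * exp (- 2 * c * s\<^sup>2)"
  proof -
    have "sqrt k * exp (- (k * s\<^sup>2 / (4 * t))) / (2 * sqrt (pi * t)) ^ 3
        \<le> sqrt k * exp (- 2 * c * s\<^sup>2) / (2 * sqrt (pi * a)) ^ 3"
      using assms t expo by (intro frac_le mult_left_mono power_mono mult_nonneg_nonneg) auto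
    then show ?thesis by (simp add: P_def)
  qed
  have "norm (fund_sol k y t) \<le> (P * exp (- 2 * c * s\<^sup>2)) * ((A + B / c) * exp (c * s\<^sup>2))"
  proof (rule order.trans[OF norm_fund_sol_le[OF \<open>k > 0\<close> \<open>t > 0\<close>, of y, folded s_def]],
      rule mult_mono[OF pre])
    show "k / (2 * t) * s + (3 / (2 * t) + k * s\<^sup>2 / (4 * t\<^sup>2)) + k\<^sup>2 \<le> (A + B / c) * exp (c * s\<^sup>2)"
      using poly absorb by (rule order.trans)
  qed (use pos assms \<open>t > 0\<close> \<open>s \<ge> 0\<close> in simp_all)
  also have "\<dots> = P * (A + B / c) * (exp (- 2 * c * s\<^sup>2) * exp (c * s\<^sup>2))"
    by (simp only: mult_ac)
  also have "exp (- 2 * c * s\<^sup>2) * exp (c * s\<^sup>2) = exp (- c * s\<^sup>2)"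
    by (simp flip: exp_add)
  finally show "norm (fund_sol k y t) \<le> P * (A + B / c) * exp (- (k / (8 * b)) * (norm y)\<^sup>2)"
    by (simp add: c_def s_def)
qed

text \<open>The projection of K to the time axis is compact, so it attains its minimum; being a time
  occurring in K, this minimum is positive.\<close>

lemma compact_space_time_bounds:
  fixes K :: "('a::real_normed_vector \<times> real) set"
  assumes "compact K" "K \<subseteq> UNIV \<times> {0<..}"
  obtains R a b where "a > 0" "b > 0" "\<And>x t. (x, t) \<in> K \<Longrightarrow> norm x \<le> R \<and> a \<le> t \<and> t \<le> b"
proof (cases "K = {}")
  case True
  \<comment> \<open>An empty K has no extremal times; the bounds then hold vacuously.\<close>
  then show ?thesis using that[of 1 1] by simp
next
  case False
  have "compact (fst ` K)" "compact (snd ` K)"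
    using assms(1) by (auto intro!: compact_continuous_image continuous_intros)
  obtain R where R: "\<forall>x\<in>fst ` K. norm x \<le> R"
    using compact_imp_bounded[OF \<open>compact (fst ` K)\<close>] by (auto simp: bounded_iff)
  obtain a where a: "a \<in> snd ` K" "\<forall>t\<in>snd ` K. a \<le> t"
    using compact_attains_inf[OF \<open>compact (snd ` K)\<close>] False by blast
  obtain b where b: "b \<in> snd ` K" "\<forall>t\<in>snd ` K. t \<le> b"
    using compact_attains_sup[OF \<open>compact (snd ` K)\<close>] False by blast
  show ?thesis
  proof
    show "a > 0" "b > 0" using a(1) b(1) assms(2) by auto
    show "norm x \<le> R \<and> a \<le> t \<and> t \<le> b" if "(x, t) \<in> K" for x t
      using R a(2) b(2) that by force
  qed
qed

theorem theorem5:
  fixes k :: real and l :: nat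
  assumes "k > 0" and "l \<in> {0, 1, 2, 3}"
  shows "\<forall>K :: ((real ^ 3) \<times> real) set. compact K \<and> K \<subseteq> UNIV \<times> {0<..} \<longrightarrow>
           uniform_limit K
             (\<lambda>\<Omega> (x, t). \<Sum>\<omega>\<in>\<Omega>. lattice_term l k \<omega> x t)
             (\<lambda>(x, t). lattice_series l k x t)
             (finite_subsets_at_top (split_lattice l))"
proof (intro allI impI)
  fix K :: "((real ^ 3) \<times> real) set"
  assume "compact K \<and> K \<subseteq> UNIV \<times> {0<..}"
  then obtain R a b where ab: "a > 0" "b > 0"
    and K: "\<And>x t. (x, t) \<in> K \<Longrightarrow> norm x \<le> R \<and> a \<le> t \<and> t \<le> b"
    by (metis compact_space_time_bounds)
  obtain C where "C \<ge> 0" and C: "\<And>y t. a \<le> t \<Longrightarrow> t \<le> b \<Longrightarrow>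
      norm (fund_sol k y t) \<le> C * exp (- (k / (8 * b)) * (norm y)\<^sup>2)"
    using fund_sol_gaussian_bound[OF \<open>k > 0\<close> ab] by blast
  \<comment> \<open>Passing from x + \<omega> to \<omega> costs another factor 2 in the rate, so 2c
    = k / (8b); the remaining term of the norm inequality yields the constant factor
    \<open>exp (2 * c * R\<^sup>2)\<close> in \<open>M\<close>.\<close>
  define c where "c = k / (16 * b)"
  have "c > 0" using ab assms by (simp add: c_def)
  define M where "M = (\<lambda>\<omega>::real ^ 3. C * exp (2 * c * R\<^sup>2) * exp (- c * (norm \<omega>)\<^sup>2))"
  have bound: "norm (case p of (x, t) \<Rightarrow> lattice_term l k \<omega> x t) \<le> M \<omega>" if "p \<in> K" for \<omega> p
  proof -
    obtain x t where p: "p = (x, t)" by fastforce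
    note xt = K[OF that[unfolded p]]
    have "(norm x)\<^sup>2 \<le> R\<^sup>2" using xt by (intro power_mono) auto
    then have "(norm \<omega>)\<^sup>2 / 2 - R\<^sup>2 \<le> (norm (x + \<omega>))\<^sup>2"
      using norm_sq_add_ge[of \<omega> x] by linarith
    then have "2 * c * ((norm \<omega>)\<^sup>2 / 2 - R\<^sup>2) \<le> 2 * c * (norm (x + \<omega>))\<^sup>2"
      using \<open>c > 0\<close> by (intro mult_left_mono) auto
    then have "exp (- (k / (8 * b)) * (norm (x + \<omega>))\<^sup>2) \<le> exp (2 * c * R\<^sup>2 + - c * (norm \<omega>)\<^sup>2)"
      by (simp add: c_def algebra_simps)
    then have "C * exp (- (k / (8 * b)) * (norm (x + \<omega>))\<^sup>2) \<le> M \<omega>"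
      using \<open>C \<ge> 0\<close> unfolding M_def exp_add mult.assoc by (rule mult_left_mono)
    then show ?thesis
      using C[of t "x + \<omega>"] xt by (simp add: p lattice_term_def abs_lattice_sign)
  qed
  have "M summable_on {\<omega>. \<forall>j. \<omega> $ j \<in> \<int>}"
    unfolding M_def using summable_on_integer_points_gaussian[OF \<open>c > 0\<close>]
    by (rule summable_on_cmult_right)
  then have "M summable_on split_lattice l"
    by (rule summable_on_subset) (use split_lattice_coordinate_Ints in blast)
  \<comment> \<open>The majorant \<open>M\<close> depends on \<omega> alone and is summable over the
    lattice, as the M-test requires; its limit function is the infinite sum defining
    \<open>lattice_series\<close>.\<close>
  with bound have "uniform_limit K (\<lambda>\<Omega> p. \<Sum>\<omega>\<in>\<Omega>. case p of (x, t) \<Rightarrow> lattice_term l k \<omega> x t)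
      (\<lambda>p. \<Sum>\<^sub>\<infinity>\<omega>\<in>split_lattice l. case p of (x, t) \<Rightarrow> lattice_term l k \<omega> x t)
      (finite_subsets_at_top (split_lattice l))"
    by (intro Weierstrass_m_test_general)
  then show "uniform_limit K (\<lambda>\<Omega> (x, t). \<Sum>\<omega>\<in>\<Omega>. lattice_term l k \<omega> x t)
      (\<lambda>(x, t). lattice_series l k x t) (finite_subsets_at_top (split_lattice l))"
    by (simp add: lattice_series_def case_prod_unfold)
qed

end
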